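(* For every forest $F$ and every positive integer $t$, the following two statements hold: (1) $\hat\alpha'_g(F)\le\alpha'_g(F)$. (2) $\hat\alpha'_g(F+K_{1,t})=1+\hat\alpha'_g(F)$ and $\alpha'_g(F+K_{1,t})=1+\alpha'_g(F)$.
   Context: Graphs are finite and simple. $F+K_{1,t}$ denotes the disjoint union of $F$ and the star $K_{1,t}$ with $t$ edges. The matching game on a graph $G$: two players, Max and Min, alternately add edges of $G$ to a set of chosen edges that must always remain a matching; the game ends when the chosen edges form a maximal matching of $G$ (no further edge can be added). Max wants the final matching to be large, Min wants it to be small. $\alpha'_g(G)$ denotes the size of the final matching under optimal play when Max moves first, and $\hat\alpha'_g(G)$ denotes the size of the final matching under optimal play when Min moves first. *)

theory Defs
  imports "Graph_Theory.Graph_Theory" "HOL-Library.Disjoint_Sets"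
begin

text \<open>
  A finite simple graph is a \<^locale>\<open>pair_graph\<close>: every undirected edge is represented by its two
  opposite arcs. Hence \<^const>\<open>pre_digraph.cycle\<close> also holds of the closed walk that traverses one edge
  back and forth, and \<^const>\<open>forest\<close> would exclude every graph with an edge. The cycles of
  the undirected graph are those with at least three arcs.
\<close>

definition graph_forest :: "'a pair_pre_digraph \<Rightarrow> bool" where
  "graph_forest G \<longleftrightarrow>
     pair_graph G \<and> \<not> (\<exists>p. pre_digraph.cycle (with_proj G) p \<and> 3 \<le> length p)"

definition disjoint_union ::
    "'a pair_pre_digraph \<Rightarrow> 'b pair_pre_digraph \<Rightarrow> ('a + 'b) pair_pre_digraph" where
  "disjoint_union G H =
     \<lparr> pverts = pverts G <+> pverts H,
       parcs = map_prod Inl Inl ` parcs G \<union> map_prod Inr Inr ` parcs H \<rparr>"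

definition uedges :: "'a pair_pre_digraph \<Rightarrow> 'a set set" where
  "uedges G = {{u, v} | u v. (u, v) \<in> parcs G}"

definition matching :: "'a pair_pre_digraph \<Rightarrow> 'a set set \<Rightarrow> bool" where
  "matching G M \<longleftrightarrow> M \<subseteq> uedges G \<and> disjoint M"

definition moves :: "'a pair_pre_digraph \<Rightarrow> 'a set set \<Rightarrow> 'a set set" where
  "moves G M = {e \<in> uedges G - M. matching G (insert e M)}"

lemma card_unchosen_less:
  assumes "finite (uedges G)" and "e \<in> moves G M"
  shows "card (uedges G - insert e M) < card (uedges G - M)"
  using assms by (intro psubset_card_mono) (auto simp: moves_def)

datatype player = Player_Max | Player_Min

text \<open>
  \<open>game_value G P M\<close> is the size of the final matching under optimal play from the position in
  which \<open>M\<close> has been chosen and \<open>P\<close> is to move. The finiteness test, which always succeeds for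
  finite graphs, serves only to make the recursion terminate. Below,
  \<open>max_start_number\<close> is $\alpha'_g$ and \<open>min_start_number\<close> is $\hat\alpha'_g$.
\<close>

function game_value :: "'a pair_pre_digraph \<Rightarrow> player \<Rightarrow> 'a set set \<Rightarrow> nat" where
  "game_value G Player_Max M =
     (if finite (uedges G) \<and> moves G M \<noteq> {}
      then Max ((\<lambda>e. game_value G Player_Min (insert e M)) ` moves G M)
      else card M)"
| "game_value G Player_Min M =
     (if finite (uedges G) \<and> moves G M \<noteq> {}
      then Min ((\<lambda>e. game_value G Player_Max (insert e M)) ` moves G M)
      else card M)"
  by pat_completeness auto
termination
  by (relation "measure (\<lambda>(G, P, M). card (uedges G - M))")
    (simp_all add: card_unchosen_less del: card_Diff_insert)

definition max_start_number :: "'a pair_pre_digraph \<Rightarrow> nat" where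
  "max_start_number G = game_value G Player_Max {}"

definition min_start_number :: "'a pair_pre_digraph \<Rightarrow> nat" where
  "min_start_number G = game_value G Player_Min {}"

end

theory Submission
  imports Defs
begin

text \<open>
  Playing an edge amounts to deleting its two endpoints, so a position is just a set of edges.
  Write \<open>a\<close> and \<open>b\<close> for the values of the game started by Max and by Min. For a class of graphs
  that is closed under taking subgraphs and in which every graph with an edge has a leaf, one proves
  by a simultaneous induction on the number of edges that \<open>b \<le> a\<close> and that deleting a vertex
  does not increase \<open>a\<close> or \<open>b\<close> and decreases either by at most 1. The leaf is needed only for
  \<open>b \<le> a\<close>: if \<open>u\<close> is a leaf with neighbour \<open>v\<close>, then Max may play \<open>uv\<close>, whence
  \<open>a G \<ge> 1 + b (G - v) \<ge> b G\<close>. Given \<open>b \<le> a\<close>, a player gains nothing by touching an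
  additional star component before the end of the game on the rest.
\<close>

section \<open>The game on sets of edges\<close>

definition del :: "'a set \<Rightarrow> 'a set set \<Rightarrow> 'a set set" where
  "del S E = {e \<in> E. e \<inter> S = {}}"

lemma del_subset: "del S E \<subseteq> E"
  by (auto simp: del_def)

lemma del_del: "del S (del T E) = del (S \<union> T) E"
  by (auto simp: del_def)

lemma del_commute: "del S (del T E) = del T (del S E)"
  by (simp add: del_del Un_commute)

lemma del_notin: "x \<notin> \<Union>E \<Longrightarrow> del {x} E = E"
  by (auto simp: del_def)

lemma card_del_less:
  assumes "finite E" "e \<in> E" "e \<inter> S \<noteq> {}"
  shows "card (del S E) < card E"
  using assms by (intro psubset_card_mono) (auto simp: del_def)

text \<open>The value counts the moves still to come. The test \<open>{} \<notin> E\<close> serves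
  termination: an empty edge is disjoint from itself, so playing it would delete nothing.\<close>

function edge_game_value :: "player \<Rightarrow> 'a set set \<Rightarrow> nat" where
  "edge_game_value Player_Max E =
     (if finite E \<and> {} \<notin> E \<and> E \<noteq> {}
      then Max ((\<lambda>e. Suc (edge_game_value Player_Min (del e E))) ` E) else 0)"
| "edge_game_value Player_Min E =
     (if finite E \<and> {} \<notin> E \<and> E \<noteq> {}
      then Min ((\<lambda>e. Suc (edge_game_value Player_Max (del e E))) ` E) else 0)"
  by pat_completeness auto
termination
  by (relation "measure (\<lambda>(P, E). card E)") (auto intro!: card_del_less)

declare game_value.simps [simp del] edge_game_value.simps [simp del]

abbreviation max_value :: "'a set set \<Rightarrow> nat" where
  "max_value \<equiv> edge_game_value Player_Max"

abbreviation min_value :: "'a set set \<Rightarrow> nat" where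
  "min_value \<equiv> edge_game_value Player_Min"

lemma edge_game_value_empty [simp]: "edge_game_value P {} = 0"
  by (cases P) (simp_all add: edge_game_value.simps)

text \<open>This is acyclicity in the form in which the induction uses it. Quantifying over all
  nonempty subsets \<open>E'\<close> makes the property pass to every position that can
  arise.\<close>

locale leafy =
  fixes E :: "'a set set"
  assumes finite_edges: "finite E"
    and card_edge: "e \<in> E \<Longrightarrow> card e = 2"
    and leaf: "E' \<subseteq> E \<Longrightarrow> E' \<noteq> {} \<Longrightarrow> \<exists>u e. {f \<in> E'. u \<in> f} = {e}"
begin

lemma leafy_subset: "E' \<subseteq> E \<Longrightarrow> leafy E'"
  using finite_edges card_edge leaf by unfold_locales (auto intro: finite_subset)

lemma leafy_del: "leafy (del S E)"
  by (rule leafy_subset[OF del_subset])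

lemma empty_notin_edges: "{} \<notin> E"
  using card_edge by force

lemma card_del_edge_less: "e \<in> E \<Longrightarrow> card (del e E) < card E"
  using card_del_less[OF finite_edges, of e e] empty_notin_edges by auto

lemma card_del_vertex_less: "x \<in> \<Union>E \<Longrightarrow> card (del {x} E) < card E"
  using card_del_less[OF finite_edges] by auto

lemma edgeE:
  assumes "e \<in> E" "x \<in> e"
  obtains z where "e = {x, z}" "x \<noteq> z"
  using card_edge[OF assms(1)] assms(2) by (auto simp: card_2_iff doubleton_eq_iff)

lemma max_value_ge: "e \<in> E \<Longrightarrow> Suc (min_value (del e E)) \<le> max_value E"
  using finite_edges empty_notin_edges
  by (subst edge_game_value.simps) (auto intro!: Max_ge)

lemma max_value_attained:
  assumes "E \<noteq> {}"
  obtains e where "e \<in> E" "max_value E = Suc (min_value (del e E))"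
proof -
  have "Max ((\<lambda>e. Suc (min_value (del e E))) ` E) \<in> (\<lambda>e. Suc (min_value (del e E))) ` E"
    using finite_edges assms by (intro Max_in) auto
  moreover have "max_value E = Max ((\<lambda>e. Suc (min_value (del e E))) ` E)"
    using finite_edges assms empty_notin_edges by (simp add: edge_game_value.simps(1)[of E])
  ultimately show thesis using that by auto
qed

lemma min_value_le: "e \<in> E \<Longrightarrow> min_value E \<le> Suc (max_value (del e E))"
  using finite_edges empty_notin_edges
  by (subst edge_game_value.simps) (auto intro!: Min_le)

lemma min_value_attained:
  assumes "E \<noteq> {}"
  obtains e where "e \<in> E" "min_value E = Suc (max_value (del e E))"
proof -
  have "Min ((\<lambda>e. Suc (max_value (del e E))) ` E) \<in> (\<lambda>e. Suc (max_value (del e E))) ` E"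
    using finite_edges assms by (intro Min_in) auto
  moreover have "min_value E = Min ((\<lambda>e. Suc (max_value (del e E))) ` E)"
    using finite_edges assms empty_notin_edges by (simp add: edge_game_value.simps(2)[of E])
  ultimately show thesis using that by auto
qed

end

section \<open>Effect of deleting a vertex, and the comparison of the two starting players\<close>

lemma leafy_values:
  assumes "leafy E"
  shows "min_value E \<le> max_value E"
    and "max_value (del {x} E) \<le> max_value E"
    and "min_value (del {x} E) \<le> min_value E"
    and "max_value E \<le> Suc (max_value (del {x} E))"
    and "min_value E \<le> Suc (min_value (del {x} E))"
proof -
  have "min_value E \<le> max_value E \<and> (\<forall>x.
      max_value (del {x} E) \<le> max_value E \<and> min_value (del {x} E) \<le> min_value E \<and>
      max_value E \<le> Suc (max_value (del {x} E)) \<and> min_value E \<le> Suc (min_value (del {x} E)))"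
    using assms
  proof (induction "card E" arbitrary: E rule: less_induct)
    case less
    interpret leafy E by fact
    \<comment> \<open>\<open>vertex\<close> holds the induction hypothesis on vertex deletion for
      smaller subsets of \<open>E\<close>; \<open>edge'\<close> is its instance for the position
      after an edge \<open>e\<close> has been played.\<close>
    note vertex = less.hyps[THEN conjunct2, rule_format, OF _ leafy_subset]
    note edge' = vertex[OF card_del_edge_less del_subset]
    have delete_vertex: "max_value (del {x} E) \<le> max_value E \<and> min_value (del {x} E) \<le> min_value E \<and>
      max_value E \<le> Suc (max_value (del {x} E)) \<and> min_value E \<le> Suc (min_value (del {x} E))" for x
    proof (cases "x \<in> \<Union>E")
      case False
      then show ?thesis by (simp add: del_notin)
    next
      case True
      define H where "H = del {x} E"
      have H: "leafy H" "card H < card E" "H \<subseteq> E"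
        using True by (simp_all add: H_def leafy_del card_del_vertex_less del_subset)
      have E: "E \<noteq> {}" using True by auto
      have H_le: "min_value H \<le> max_value H" using less.hyps[OF H(2,1)] by simp
      have delH: "del e H = del {x} (del e E)" for e
        by (simp add: H_def del_commute)
      have delxz: "del {x, z} E = del {z} H" for z
        by (simp add: H_def del_del insert_commute)
      interpret H: leafy H by fact
      \<comment> \<open>Max can copy in \<open>E\<close> an optimal first move for \<open>H\<close>.
        The two resulting positions again differ by the deletion of \<open>x\<close>, so the
        induction hypothesis compares them.\<close>
      have max_mono: "max_value H \<le> max_value E"
      proof (cases "H = {}")
        case False
        then obtain e where e: "e \<in> H" "max_value H = Suc (min_value (del e H))"
          by (rule H.max_value_attained)
        have "e \<in> E" using e(1) H(3) by auto
        then show ?thesis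
          using e(2) edge'[of e x] max_value_ge[of e] by (simp add: delH)
      qed simp
      have min_mono: "min_value H \<le> min_value E"
      proof (cases "H = {}")
        case False
        obtain e where e: "e \<in> E" "min_value E = Suc (max_value (del e E))"
          using E by (rule min_value_attained)
        show ?thesis
        proof (cases "x \<in> e")
          case False
          then have "e \<in> H" using e(1) by (simp add: H_def del_def)
          then show ?thesis
            using e H.min_value_le[of e] edge'[of e x] by (simp add: delH)
        next
          case True
          then obtain z where z: "e = {x, z}" "x \<noteq> z" using e(1) by (auto elim: edgeE)
          \<comment> \<open>Min's optimal edge uses \<open>x\<close> and is missing from
            \<open>H\<close>. If \<open>z\<close> is isolated in \<open>H\<close>, then playing
            \<open>e\<close> in \<open>E\<close> leaves exactly \<open>H\<close>, and
            \<open>H_le\<close> suffices. Otherwise Min plays in \<open>H\<close> some edge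
            \<open>f\<close> at \<open>z\<close>; compared with \<open>del e E\<close>, this deletes
            only the additional vertex \<open>y\<close>, which does not increase the value for
            Max.\<close>
          show ?thesis
          proof (cases "z \<in> \<Union>H")
            case False
            then show ?thesis using e z H_le by (simp add: delxz del_notin)
          next
            case True
            then obtain f where f: "f \<in> H" "z \<in> f" by auto
            then obtain y where y: "f = {z, y}" "z \<noteq> y" by (auto elim: H.edgeE)
            have "card (del {z} H) < card E"
              using H.card_del_vertex_less[OF True] H(2) by simp
            from less.hyps[OF this H.leafy_del]
            have "max_value (del {y} (del {z} H)) \<le> max_value (del {z} H)" by blast
            moreover have "del {y} (del {z} H) = del f H"
              by (simp add: y del_del insert_commute)
            ultimately show ?thesis
              using H.min_value_le[OF f(1)] e(2) by (simp add: z delxz)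
          qed
        qed
      qed simp
      have max_cont: "max_value E \<le> Suc (max_value H)"
      proof -
        obtain e where e: "e \<in> E" "max_value E = Suc (min_value (del e E))"
          using E by (rule max_value_attained)
        show ?thesis
        proof (cases "x \<in> e")
          case False
          then have "e \<in> H" using e(1) by (simp add: H_def del_def)
          then show ?thesis
            using e H.max_value_ge[of e] edge'[of e x] by (simp add: delH)
        next
          case True
          then obtain z where z: "e = {x, z}" "x \<noteq> z" using e(1) by (auto elim: edgeE)
          \<comment> \<open>Here \<open>del e E\<close> is \<open>del {z} H\<close>, so the bound
            follows from the chain
            \<open>min_value (del {z} H) \<le> min_value H \<le> max_value H\<close>.\<close>
          have "min_value (del {z} H) \<le> min_value H"
            using less.hyps[OF H(2,1)] by blast
          then show ?thesis using e z H_le by (simp add: delxz)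
        qed
      qed
      \<comment> \<open>Min copies in \<open>E\<close> an optimal move for \<open>H\<close>. If
        \<open>H\<close> is empty there is nothing to copy, but then any edge at \<open>x\<close>
        ends the game after one move.\<close>
      have min_cont: "min_value E \<le> Suc (min_value H)"
      proof (cases "H = {}")
        case True
        obtain e where e: "e \<in> E" "x \<in> e" using \<open>x \<in> \<Union>E\<close> by auto
        then have "del e E \<subseteq> H" by (auto simp: H_def del_def)
        then show ?thesis using min_value_le[OF e(1)] True by simp
      next
        case False
        then obtain e where e: "e \<in> H" "min_value H = Suc (max_value (del e H))"
          by (rule H.min_value_attained)
        have "e \<in> E" using e(1) H(3) by auto
        then show ?thesis
          using e(2) edge'[of e x] min_value_le[of e] by (simp add: delH)
      qed
      show ?thesis
        using max_mono min_mono max_cont min_cont by (simp add: H_def)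
    qed
    moreover have "min_value E \<le> max_value E"
    proof (cases "E = {}")
      case False
      then obtain u e where u: "{f \<in> E. u \<in> f} = {e}" using leaf[of E] by auto
      then have e: "e \<in> E" "u \<in> e" by auto
      then obtain v where v: "e = {u, v}" by (auto elim: edgeE)
      \<comment> \<open>No other edge meets the leaf \<open>u\<close>, so playing \<open>e\<close>
        only costs the vertex \<open>v\<close>. The bound on deleting \<open>v\<close> is needed for
        \<open>E\<close> itself, which is why \<open>delete_vertex\<close> comes first.\<close>
      have "del e E = del {v} E" using u v by (auto simp: del_def)
      then show ?thesis using max_value_ge[OF e(1)] delete_vertex[of v] by simp
    qed simp
    ultimately show ?case by blast
  qed
  then show "min_value E \<le> max_value E"
    "max_value (del {x} E) \<le> max_value E"
    "min_value (del {x} E) \<le> min_value E"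
    "max_value E \<le> Suc (max_value (del {x} E))"
    "min_value E \<le> Suc (min_value (del {x} E))"
    by blast+
qed

section \<open>Relabelling of vertices, and adding a star\<close>

lemma del_image:
  assumes "inj f"
  shows "del (f ` e) ((`) f ` E) = (`) f ` del e E"
proof -
  have "f ` d \<inter> f ` e = {} \<longleftrightarrow> d \<inter> e = {}" for d
    by (simp add: image_Int[OF assms, symmetric])
  then show ?thesis by (auto simp: del_def)
qed

lemma finite_image_image_iff: "inj f \<Longrightarrow> finite ((`) f ` E) \<longleftrightarrow> finite E"
  by (intro finite_image_iff inj_onI) (simp add: inj_image_eq_iff)

text \<open>Needed because the disjoint union tags the vertices of its two parts with
  \<open>Inl\<close> and \<open>Inr\<close>.\<close>

lemma edge_game_value_image:
  assumes "inj f"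
  shows "edge_game_value P ((`) f ` E) = edge_game_value P E"
proof (induction P E rule: edge_game_value.induct)
  case (1 E)
  then show ?case
    by (cases "finite E \<and> {} \<notin> E \<and> E \<noteq> {}")
      (auto simp: edge_game_value.simps(1) image_image del_image[OF assms]
        finite_image_image_iff[OF assms] cong: image_cong)
next
  case (2 E)
  then show ?case
    by (cases "finite E \<and> {} \<notin> E \<and> E \<noteq> {}")
      (auto simp: edge_game_value.simps(2) image_image del_image[OF assms]
        finite_image_image_iff[OF assms] cong: image_cong)
qed

lemma leafy_image:
  assumes "leafy E" "inj f"
  shows "leafy ((`) f ` E)"
proof -
  interpret leafy E by fact
  show ?thesis
  proof
    fix E' assume "E' \<subseteq> (`) f ` E" "E' \<noteq> {}"
    then obtain D where D: "E' = (`) f ` D" "D \<subseteq> E" "D \<noteq> {}"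
      by (auto simp: subset_image_iff)
    obtain u e where "{d \<in> D. u \<in> d} = {e}" using leaf[OF D(2,3)] by auto
    moreover have "{d \<in> E'. f u \<in> d} = (`) f ` {d \<in> D. u \<in> d}"
      by (auto simp: D(1) inj_eq[OF assms(2)])
    ultimately have "{d \<in> E'. f u \<in> d} = {f ` e}" by simp
    then show "\<exists>u e. {d \<in> E'. u \<in> d} = {e}" by blast
  qed (use finite_edges card_edge assms(2) in
      \<open>auto simp: card_image[OF inj_on_subset[OF assms(2) subset_UNIV]]\<close>)
qed

text \<open>As the edges of \<open>T\<close> pairwise meet, playing one of them uses up all of
  \<open>T\<close> and hands \<open>E\<close> to the opponent. Since
  \<open>min_value E \<le> max_value E\<close>, such a move is never better than the claimed value;
  the moves inside \<open>E\<close> are settled by induction.\<close>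

lemma edge_game_value_Un_star:
  assumes "leafy E" "finite T" "T \<noteq> {}" "\<And>s t. s \<in> T \<Longrightarrow> t \<in> T \<Longrightarrow> s \<inter> t \<noteq> {}"
    and "\<Union>E \<inter> \<Union>T = {}"
  shows "edge_game_value P (E \<union> T) = Suc (edge_game_value P E)"
  using assms(1,5)
proof (induction "card E" arbitrary: E P rule: less_induct)
  case less
  interpret leafy E by fact
  \<comment> \<open>The case \<open>s = t\<close> of the intersection hypothesis shows that the
    members of \<open>T\<close> are nonempty.\<close>
  have fin: "finite (E \<union> T)" "{} \<notin> E \<union> T" "E \<union> T \<noteq> {}"
    using finite_edges assms(2-4) empty_notin_edges by auto
  have IH: "edge_game_value P (del e (E \<union> T)) = Suc (edge_game_value P (del e E))"
    if "e \<in> E" for e P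
  proof -
    have "del e (E \<union> T) = del e E \<union> T"
      using that less.prems(2) by (auto simp: del_def)
    moreover have "\<Union>(del e E) \<inter> \<Union>T = {}" using less.prems(2) by (auto simp: del_def)
    ultimately show ?thesis
      using less.hyps[OF card_del_edge_less[OF that] leafy_del] by simp
  qed
  have T: "del t (E \<union> T) = E" if "t \<in> T" for t
    using that less.prems(2) assms(4) by (auto simp: del_def)
  have le: "min_value E \<le> max_value E" by (rule leafy_values(1)) fact
  obtain t where t: "t \<in> T" using assms(3) by auto
  show ?case
  proof (cases P)
    case Player_Max
    have "Max ((\<lambda>e. Suc (min_value (del e (E \<union> T)))) ` (E \<union> T)) = Suc (max_value E)"
    proof (rule Max_eqI)
      show "y \<le> Suc (max_value E)"
        if "y \<in> (\<lambda>e. Suc (min_value (del e (E \<union> T)))) ` (E \<union> T)" for y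
        using that IH T le max_value_ge by auto
      show "Suc (max_value E) \<in> (\<lambda>e. Suc (min_value (del e (E \<union> T)))) ` (E \<union> T)"
      \<comment> \<open>With \<open>E\<close> empty only star edges can be played, and one of them
        attains the value 1. Otherwise an optimal move in \<open>E\<close> remains optimal.\<close>
      proof (cases "E = {}")
        case True
        then show ?thesis using t T[OF t] by (auto intro!: image_eqI[of _ _ t])
      next
        case False
        then obtain e where "e \<in> E" "max_value E = Suc (min_value (del e E))"
          by (rule max_value_attained)
        then show ?thesis using IH by (auto intro!: image_eqI[of _ _ e])
      qed
    qed (use fin in simp)
    then show ?thesis
      using fin by (simp add: Player_Max edge_game_value.simps(1)[of "E \<union> T"])
  next
    case Player_Min
    have "Min ((\<lambda>e. Suc (max_value (del e (E \<union> T)))) ` (E \<union> T)) = Suc (min_value E)"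
    proof (rule Min_eqI)
      show "Suc (min_value E) \<le> y"
        if "y \<in> (\<lambda>e. Suc (max_value (del e (E \<union> T)))) ` (E \<union> T)" for y
        using that IH T le min_value_le by auto
      show "Suc (min_value E) \<in> (\<lambda>e. Suc (max_value (del e (E \<union> T)))) ` (E \<union> T)"
      proof (cases "E = {}")
        case True
        then show ?thesis using t T[OF t] by (auto intro!: image_eqI[of _ _ t])
      next
        case False
        then obtain e where "e \<in> E" "min_value E = Suc (max_value (del e E))"
          by (rule min_value_attained)
        then show ?thesis using IH by (auto intro!: image_eqI[of _ _ e])
      qed
    qed (use fin in simp)
    then show ?thesis
      using fin by (simp add: Player_Min edge_game_value.simps(2)[of "E \<union> T"])
  qed
qed

section \<open>From chosen matchings to remaining edges\<close>

lemma moves_eq_del: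
  assumes "matching G M" "{} \<notin> uedges G"
  shows "moves G M = del (\<Union>M) (uedges G)"
proof -
  have "disjoint (insert e M) \<longleftrightarrow> e \<inter> \<Union>M = {}" if "e \<notin> M" for e
    using that assms(1) by (auto simp: matching_def disjoint_def)
  \<comment> \<open>An edge that avoids all chosen vertices is automatically new, because a nonempty
    chosen edge would meet itself.\<close>
  moreover have "e \<notin> M" if "e \<in> del (\<Union>M) (uedges G)" for e
  proof
    assume "e \<in> M"
    then have "e = {}" using that by (auto simp: del_def)
    then show False using that assms(2) by (simp add: del_def)
  qed
  ultimately show ?thesis
    using assms(1) by (auto simp: moves_def matching_def del_def)
qed

text \<open>The final size splits into the moves already made, counted by \<open>card M\<close>, and
  those made on the edges that avoid the chosen vertices.\<close>

lemma game_value_eq_edge_game_value: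
  assumes "finite (uedges G)" "{} \<notin> uedges G" "matching G M"
  shows "game_value G P M = edge_game_value P (del (\<Union>M) (uedges G)) + card M"
  using assms
proof (induction G P M rule: game_value.induct)
  case (1 G M)
  let ?R = "del (\<Union>M) (uedges G)"
  have R: "finite ?R" "{} \<notin> ?R" using 1 by (auto simp: del_def)
  have mv: "moves G M = ?R" by (rule moves_eq_del) fact+
  have "finite M" using 1 by (auto simp: matching_def intro: finite_subset)
  have IH: "game_value G Player_Min (insert e M) = Suc (min_value (del e ?R)) + card M"
    if "e \<in> ?R" for e
  proof -
    have e: "e \<in> moves G M" using that mv by simp
    then have "matching G (insert e M)" "e \<notin> M" by (auto simp: moves_def)
    moreover have "?R \<noteq> {}" using that by auto
    ultimately show ?thesis
      using 1 e \<open>finite M\<close> mv by (auto simp: del_del)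
  qed
  show ?case
  proof (cases "?R = {}")
    case False
    \<comment> \<open>Every option carries the same summand \<open>card M\<close>, which can
      therefore leave the maximum. Keeping \<open>add_Suc\<close> out of the simplifier preserves
      the shape \<open>Suc _ + card M\<close> for this.\<close>
    have "game_value G Player_Max M = Max ((\<lambda>e. Suc (min_value (del e ?R)) + card M) ` ?R)"
      using False "1.prems"(1) by (simp add: game_value.simps(1)[of G M] mv IH del: add_Suc cong: image_cong)
    also have "\<dots> = Max ((\<lambda>e. Suc (min_value (del e ?R))) ` ?R) + card M"
      using R False by (intro Max_add_commute)
    finally show ?thesis
      using False R by (simp add: edge_game_value.simps(1)[of ?R])
  qed (simp add: game_value.simps(1) mv)
next
  case (2 G M)
  let ?R = "del (\<Union>M) (uedges G)"
  have R: "finite ?R" "{} \<notin> ?R" using 2 by (auto simp: del_def)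
  have mv: "moves G M = ?R" by (rule moves_eq_del) fact+
  have "finite M" using 2 by (auto simp: matching_def intro: finite_subset)
  have IH: "game_value G Player_Max (insert e M) = Suc (max_value (del e ?R)) + card M"
    if "e \<in> ?R" for e
  proof -
    have e: "e \<in> moves G M" using that mv by simp
    then have "matching G (insert e M)" "e \<notin> M" by (auto simp: moves_def)
    moreover have "?R \<noteq> {}" using that by auto
    ultimately show ?thesis
      using 2 e \<open>finite M\<close> mv by (auto simp: del_del)
  qed
  show ?case
  proof (cases "?R = {}")
    case False
    have "game_value G Player_Min M = Min ((\<lambda>e. Suc (max_value (del e ?R)) + card M) ` ?R)"
      using False "2.prems"(1) by (simp add: game_value.simps(2)[of G M] mv IH del: add_Suc cong: image_cong)
    also have "\<dots> = Min ((\<lambda>e. Suc (max_value (del e ?R))) ` ?R) + card M"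
      using R False by (intro Min_add_commute)
    finally show ?thesis
      using False R by (simp add: edge_game_value.simps(2)[of ?R])
  qed (simp add: game_value.simps(2) mv)
qed

lemma start_numbers_eq:
  assumes "finite (uedges G)"
  shows "max_start_number G = max_value (uedges G)"
    and "min_start_number G = min_value (uedges G)"
proof -
  have *: "{} \<notin> uedges G" by (auto simp: uedges_def)
  have **: "matching G {}" "del {} (uedges G) = uedges G"
    by (auto simp: matching_def disjoint_def del_def)
  show "max_start_number G = max_value (uedges G)" "min_start_number G = min_value (uedges G)"
    using game_value_eq_edge_game_value[OF assms * **(1)] **(2)
    by (simp_all add: max_start_number_def min_start_number_def)
qed

section \<open>Forests have leaves\<close>

lemma pcas_zip_tl:
  "xs \<noteq> [] \<Longrightarrow> pcas (hd xs) (zip xs (tl xs)) (last xs)"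
proof (induction xs)
  case (Cons x xs) then show ?case by (cases xs) auto
qed simp

lemma pawalk_verts_zip_tl:
  "xs \<noteq> [] \<Longrightarrow> pawalk_verts (hd xs) (zip xs (tl xs)) = xs"
proof (induction xs)
  case (Cons x xs) then show ?case by (cases xs) auto
qed simp

lemma set_zip_tl_subset:
  "successively (\<lambda>u v. (u, v) \<in> A) xs \<Longrightarrow> set (zip xs (tl xs)) \<subseteq> A"
proof (induction xs)
  case (Cons x xs) then show ?case by (cases xs) auto
qed simp

lemma uedges_conv: "uedges G = (\<lambda>(u, v). {u, v}) ` parcs G"
  by (auto simp: uedges_def)

lemma (in pair_graph) doubleton_uedges_iff: "{u, v} \<in> uedges G \<longleftrightarrow> (u, v) \<in> parcs G"
  using pair_sym_arcs by (auto simp: uedges_def doubleton_eq_iff symmetric_def dest: symD)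

lemma (in pair_graph) finite_uedges: "finite (uedges G)"
  by (simp add: uedges_conv)

lemma (in pair_graph) card_uedge: "e \<in> uedges G \<Longrightarrow> card e = 2"
  using pair_no_loops by (fastforce simp: uedges_def)

text \<open>Longest path argument: in a nonempty edge set without a leaf, the first vertex of a
  longest path has a second neighbour. By maximality it lies on the path, which closes a
  cycle.\<close>

lemma graph_forest_leafy:
  assumes "graph_forest G"
  shows "leafy (uedges G)"
proof -
  interpret pair_graph G using assms by (simp add: graph_forest_def)
  show ?thesis
  proof (rule leafy.intro)
    fix E assume E: "E \<subseteq> uedges G" "E \<noteq> {}"
    show "\<exists>u e. {f \<in> E. u \<in> f} = {e}"
    proof (rule ccontr)
      assume no_leaf: "\<nexists>u e. {f \<in> E. u \<in> f} = {e}"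
      define path where "path xs \<longleftrightarrow> xs \<noteq> [] \<and> distinct xs \<and> successively (\<lambda>u v. {u, v} \<in> E) xs
        \<and> set xs \<subseteq> \<Union>E" for xs
      have "finite e" if "e \<in> E" for e
        using that E(1) card_uedge[of e] by (intro card_ge_0_finite) auto
      then have "finite (\<Union>E)"
        using finite_subset[OF E(1) finite_uedges] by blast
      then have bound: "length xs \<le> card (\<Union>E)" if "path xs" for xs
        using that by (metis path_def card_mono distinct_card)
      obtain e x0 where "e \<in> E" "x0 \<in> e"
        using E card_uedge by (metis all_not_in_conv card.empty subsetD zero_neq_numeral)
      then have "path [x0]" by (auto simp: path_def)
      \<comment> \<open>The length bound is passed as a strict one, hence the
        \<open>Suc\<close>.\<close>
      then have "\<exists>xs. path xs \<and> (\<forall>ys. path ys \<longrightarrow> length ys \<le> length xs)"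
        using bound by (intro ex_has_greatest_nat[of path "[x0]" length "Suc (card (\<Union>E))"])
            (simp_all add: less_Suc_eq_le)
      then obtain xs where xs: "path xs" "\<And>ys. path ys \<Longrightarrow> length ys \<le> length xs"
        by blast
      obtain x ys where x: "xs = x # ys" using xs(1) by (cases xs) (auto simp: path_def)
      \<comment> \<open>Since \<open>x\<close> is not a leaf, it has a neighbour other than its successor on the path.\<close>
      obtain w where w: "{x, w} \<in> E" "ys = [] \<or> w \<noteq> hd ys" "w \<noteq> x"
      proof -
        obtain e where e: "e \<in> E" "x \<in> e" using xs(1) x by (auto simp: path_def)
        \<comment> \<open>For empty \<open>ys\<close> the value of \<open>hd ys\<close> is
          unspecified, but harmless: the set of edges at \<open>x\<close> is not a singleton,
          whichever edge is named.\<close>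
        then have "{f \<in> E. x \<in> f} \<noteq> {{x, hd ys}}" and "{f \<in> E. x \<in> f} \<noteq> {}"
          using no_leaf by auto
        then obtain f where f: "f \<in> E" "x \<in> f" "f \<noteq> {x, hd ys}" by auto
        then obtain w where "f = {x, w}" "w \<noteq> x"
          using card_uedge[of f] E(1) by (auto simp: card_2_iff doubleton_eq_iff)
        then show thesis using f that by auto
      qed
      have "w \<in> set ys"
      proof (rule ccontr)
        assume "w \<notin> set ys"
        then have "path (w # xs)"
          using w xs(1) x by (auto simp: path_def insert_commute)
        then show False using xs(2) by fastforce
      qed
      then obtain us vs where ys: "ys = us @ w # vs" by (auto dest: split_list)
      define c where "c = x # us @ [w, x]"
      \<comment> \<open>As \<open>w\<close> is not the successor of \<open>x\<close>, some vertex
        lies between them. This gives the cycle at least three arcs and rules out an edge traversed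
        back and forth.\<close>
      have "us \<noteq> []" using w(2) ys by auto
      have "successively (\<lambda>u v. {u, v} \<in> E) c"
        using xs(1) w(1) \<open>us \<noteq> []\<close>
        by (auto simp: path_def x ys c_def successively_append_iff successively_Cons insert_commute)
      then have "successively (\<lambda>u v. (u, v) \<in> parcs G) c"
        by (rule successively_mono) (use E(1) doubleton_uedges_iff in blast)
      then have arcs: "set (zip c (tl c)) \<subseteq> parcs G" by (rule set_zip_tl_subset)
      have "x \<in> pverts G"
        using w(1) E(1) doubleton_uedges_iff in_arcsD1 by blast
      \<comment> \<open>Walks are lists of arcs; \<open>zip c (tl c)\<close> joins consecutive
        entries of the vertex list \<open>c\<close>.\<close>
      then have "awalk x (zip c (tl c)) x"
        using arcs pcas_zip_tl[of c] by (simp add: awalk_def c_def)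
      moreover have "distinct (tl (pawalk_verts x (zip c (tl c))))"
        using pawalk_verts_zip_tl[of c] xs(1) by (auto simp: c_def path_def x ys)
      moreover have "3 \<le> length (zip c (tl c))"
        using \<open>us \<noteq> []\<close> by (cases us) (auto simp: c_def)
      ultimately have "\<exists>p. cycle p \<and> 3 \<le> length p"
        unfolding cycle_def by (metis list.size(3) not_numeral_le_zero)
      then show False using assms by (simp add: graph_forest_def)
    qed
  qed (simp_all add: finite_uedges card_uedge)
qed

section \<open>The forest together with a disjoint star\<close>

lemma uedges_disjoint_union:
  "uedges (disjoint_union G H) = (`) Inl ` uedges G \<union> (`) Inr ` uedges H"
  by (simp add: uedges_conv disjoint_union_def image_Un image_image case_prod_beta)

text \<open>The vertex \<open>c\<close> is the centre, the only member of the side of size 1.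
  Sharing it makes the edges pairwise intersecting, as \<open>edge_game_value_Un_star\<close>
  requires.\<close>

lemma star_uedges:
  assumes "K\<^bsub>1,t\<^esub> (with_proj S)" "t > 0"
  obtains c where "finite (uedges S)" "uedges S \<noteq> {}" "\<forall>e\<in>uedges S. c \<in> e"
proof -
  interpret pair_graph S using assms(1) by (rule pair_graphI_complete_bipartite)
  obtain U V where UV: "card U = 1" "card V = t" "parcs S = U \<times> V \<union> V \<times> U"
    using assms(1) by (auto simp: complete_bipartite_digraph_pair_def)
  then obtain c where c: "U = {c}" by (auto simp: card_1_singleton_iff)
  have "V \<noteq> {}" using UV(2) assms(2) by auto
  then have "uedges S \<noteq> {}" using UV(3) c by (auto simp: uedges_def)
  moreover have "c \<in> e" if "e \<in> uedges S" for e
    using that UV(3) c by (auto simp: uedges_def)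
  ultimately show thesis using that[of c] finite_uedges by blast
qed

theorem theorem4p3:
  fixes F :: "'a pair_pre_digraph" and t :: nat
  assumes "graph_forest F" and "t > 0"
  shows "min_start_number F \<le> max_start_number F \<and>
    (\<forall>S :: 'b pair_pre_digraph. K\<^bsub>1,t\<^esub> (with_proj S) \<longrightarrow>
       min_start_number (disjoint_union F S) = 1 + min_start_number F \<and>
       max_start_number (disjoint_union F S) = 1 + max_start_number F)"
proof (intro conjI[of "_ \<le> _"] allI impI)
  interpret leafy "uedges F" using assms(1) by (rule graph_forest_leafy)
  have F: "leafy (uedges F)" by (rule leafy_axioms)
  show "min_start_number F \<le> max_start_number F"
    using leafy_values(1)[OF F] by (simp add: start_numbers_eq finite_edges)
  fix S :: "'b pair_pre_digraph"
  assume "K\<^bsub>1,t\<^esub> (with_proj S)"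
  then obtain c where S: "finite (uedges S)" "uedges S \<noteq> {}" "\<forall>e\<in>uedges S. c \<in> e"
    using assms(2) by (rule star_uedges)
  let ?E = "(`) Inl ` uedges F :: ('a + 'b) set set"
  let ?T = "(`) Inr ` uedges S :: ('a + 'b) set set"
  \<comment> \<open>Any two edges of \<open>?T\<close> meet in \<open>Inr c\<close>, and the tags
    keep the vertices of \<open>?E\<close> and \<open>?T\<close> apart.\<close>
  have "edge_game_value P (?E \<union> ?T) = Suc (edge_game_value P ?E)" for P
    using S by (intro edge_game_value_Un_star leafy_image F) auto
  then have "edge_game_value P (uedges (disjoint_union F S)) = Suc (edge_game_value P (uedges F))"
    for P
    by (simp add: uedges_disjoint_union edge_game_value_image)
  moreover have "finite (uedges (disjoint_union F S))"
    using S(1) finite_edges by (simp add: uedges_disjoint_union)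
  ultimately show "min_start_number (disjoint_union F S) = 1 + min_start_number F \<and>
       max_start_number (disjoint_union F S) = 1 + max_start_number F"
    by (simp add: start_numbers_eq finite_edges)
qed

end
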